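(* Let $1\le p\le n-1$ be integers. The distance spectrum of the firefly-type graph $F_{p,n-p}$ (the multiset of eigenvalues of its distance matrix $D(F_{p,n-p})$, superscripts denoting multiplicities) is $$\left\{(-2)^{\,p-1},\ (-1)^{\,n-p},\ (-3)^{\,n-p-1},\ \lambda_1,\lambda_2,\lambda_3\right\},$$ where $\lambda_1,\lambda_2,\lambda_3$ are the roots (with multiplicity) of the polynomial $$p(x)=x^3-(4n-2p-5)x^2-(10n-3p-6)x-(4n-p).$$
   Context: The distance matrix of a connected graph $\Gamma$ is $D(\Gamma)=(d(u,v))_{u,v\in V(\Gamma)}$, where $d$ is the shortest-path distance. The firefly-type graph $F_{p,n-p}$ is $K_1\vee\left(pK_1\cup(n-p)K_2\right)$: a single vertex joined to all vertices of the disjoint union of $p$ copies of $K_1$ and $n-p$ copies of $K_2$. *)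

theory Defs
  imports "Graph_Theory.Graph_Theory" "Jordan_Normal_Form.Char_Poly"
begin

text \<open>
  A finite simple graph is represented, as in the library's locale \<^locale>\<open>pair_graph\<close>, by a
  symmetric loop-free set of arcs. Disjoint copies of vertex sets are obtained by tagging: sums
  for the union of two graphs, an index in \<open>{..<k}\<close> for \<open>k\<close> copies of one graph.
\<close>

definition complete_graph :: "nat \<Rightarrow> nat pair_pre_digraph" where
  "complete_graph k = \<lparr> pverts = {..<k}, parcs = {(u, v). u < k \<and> v < k \<and> u \<noteq> v} \<rparr>"

definition disjoint_copies :: "nat \<Rightarrow> 'a pair_pre_digraph \<Rightarrow> (nat \<times> 'a) pair_pre_digraph" where
  "disjoint_copies k G =
     \<lparr> pverts = {..<k} \<times> pverts G,
       parcs = {((i, u), (i, v)) | i u v. i < k \<and> (u, v) \<in> parcs G} \<rparr>"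

definition disjoint_union ::
    "'a pair_pre_digraph \<Rightarrow> 'b pair_pre_digraph \<Rightarrow> ('a + 'b) pair_pre_digraph" where
  "disjoint_union G H =
     \<lparr> pverts = pverts G <+> pverts H,
       parcs = {(Inl u, Inl v) | u v. (u, v) \<in> parcs G}
             \<union> {(Inr u, Inr v) | u v. (u, v) \<in> parcs H} \<rparr>"

definition graph_join ::
    "'a pair_pre_digraph \<Rightarrow> 'b pair_pre_digraph \<Rightarrow> ('a + 'b) pair_pre_digraph" where
  "graph_join G H =
     \<lparr> pverts = pverts G <+> pverts H,
       parcs = parcs (disjoint_union G H)
             \<union> {(Inl u, Inr v) | u v. u \<in> pverts G \<and> v \<in> pverts H}
             \<union> {(Inr v, Inl u) | u v. u \<in> pverts G \<and> v \<in> pverts H} \<rparr>"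

definition firefly :: "nat \<Rightarrow> nat \<Rightarrow> (nat + (nat \<times> nat + nat \<times> nat)) pair_pre_digraph" where
  "firefly p q = graph_join (complete_graph 1)
     (disjoint_union (disjoint_copies p (complete_graph 1)) (disjoint_copies q (complete_graph 2)))"

text \<open>
  The shortest-path distance is the library's minimal walk cost \<open>\<mu>\<close> for unit arc weights. It is
  extended-real valued (infinite for unreachable vertices), but finite on connected graphs.
\<close>

definition graph_dist :: "'a pair_pre_digraph \<Rightarrow> 'a \<Rightarrow> 'a \<Rightarrow> real" where
  "graph_dist G u v = real_of_ereal (wf_digraph.\<mu> (with_proj G) (\<lambda>_. 1) u v)"

text \<open>
  Matrices are indexed by natural numbers, so the distance matrix is taken with respect to an
  enumeration \<open>vs\<close> of the vertices.
\<close>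

definition distance_matrix :: "'a pair_pre_digraph \<Rightarrow> 'a list \<Rightarrow> real mat" where
  "distance_matrix G vs =
     mat (length vs) (length vs) (\<lambda>(i, j). graph_dist G (vs ! i) (vs ! j))"

text \<open>
  Algebraic multiplicities. For a real symmetric matrix all eigenvalues are real, so nothing is
  lost by counting roots over the field of the matrix entries.
\<close>

definition eigenvalue_mset :: "'a :: field mat \<Rightarrow> 'a multiset" where
  "eigenvalue_mset A = proots (char_poly A)"

lemma set_eigenvalue_mset:
  assumes "A \<in> carrier_mat n n"
  shows "set_mset (eigenvalue_mset A) = {x. eigenvalue A x}"
  using degree_monic_char_poly[OF assms] eigenvalue_root_char_poly[OF assms]
  by (subst eigenvalue_mset_def, subst set_count_proots) auto

lemma complete_digraph_complete_graph: "complete_digraph k (with_proj (complete_graph k))"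
proof -
  have "{(u, v). u < k \<and> v < k \<and> u \<noteq> v} \<subseteq> {..<k} \<times> {..<k}" by auto
  then have "finite {(u, v). u < k \<and> v < k \<and> u \<noteq> v}" by (rule finite_subset) auto
  then have "pair_graph (complete_graph k)"
    by unfold_locales (auto simp: complete_graph_def arcs_ends_def arc_to_ends_def
        symmetric_def sym_def)
  then interpret pair_graph "complete_graph k" .
  have "graph (with_proj (complete_graph k))" by (rule graph_axioms)
  then show ?thesis
    by (auto simp: complete_digraph_def complete_graph_def)
qed

lemma pair_graph_firefly: "pair_graph (firefly p q)"
proof -
  let ?G = "firefly p q"
  have fin: "finite (pverts ?G)"
    by (simp add: firefly_def graph_join_def disjoint_union_def disjoint_copies_def
        complete_graph_def)
  have sub: "parcs ?G \<subseteq> pverts ?G \<times> pverts ?G"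
    by (auto simp: firefly_def graph_join_def disjoint_union_def disjoint_copies_def
        complete_graph_def)
  have sym: "symmetric (with_proj ?G)"
    by (auto simp: symmetric_def sym_def firefly_def graph_join_def disjoint_union_def
        disjoint_copies_def complete_graph_def)
  have loopfree: "fst e \<noteq> snd e" if "e \<in> parcs ?G" for e
    using that by (auto simp: firefly_def graph_join_def disjoint_union_def
        disjoint_copies_def complete_graph_def)
  show ?thesis
    using fin sub sym loopfree finite_subset[OF sub]
    by unfold_locales auto
qed

lemma card_pverts_firefly: "card (pverts (firefly p q)) = 1 + p + 2 * q"
  by (simp add: firefly_def graph_join_def disjoint_union_def disjoint_copies_def
      complete_graph_def card_Plus card_cartesian_product)

lemma connected_firefly: "connected (with_proj (firefly p q))"
proof -
  let ?G = "firefly p q"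
  interpret pair_graph ?G by (rule pair_graph_firefly)
  have arc: "(Inl 0, v) \<in> parcs ?G \<and> (v, Inl 0) \<in> parcs ?G" if "v \<in> pverts ?G" "v \<noteq> Inl 0" for v
    using that by (auto simp: firefly_def graph_join_def disjoint_union_def
        disjoint_copies_def complete_graph_def)
  have centre: "Inl 0 \<in> pverts ?G"
    by (auto simp: firefly_def graph_join_def complete_graph_def)
  have "Inl 0 \<rightarrow>\<^sup>*\<^bsub>with_proj ?G\<^esub> v \<and> v \<rightarrow>\<^sup>*\<^bsub>with_proj ?G\<^esub> Inl 0" if "v \<in> pverts ?G" for v
    using arc[OF that] centre that by (cases "v = Inl 0") (auto simp: reachable_adjI)
  then show ?thesis
    using centre by (intro connectedI reachable_mk_symmetricI) (auto intro: reachable_trans)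
qed

end

theory Submission
  imports Defs
begin

text \<open>
  Any two vertices are joined by a walk through the centre, of length \<open>h u + h v\<close>, where \<open>h\<close>
  is the distance to the centre (0 or 1). This is the distance except on the diagonal and
  between the two outer vertices of a triangle, so the distance matrix is \<open>D = h 1\<^sup>T + 1 h\<^sup>T - E\<close>, where \<open>E\<close> is a
  diagonal matrix plus \<open>\<Sum>\<^sub>k t\<^sub>k t\<^sub>k\<^sup>T\<close>, with \<open>t\<^sub>k\<close> the indicator vector of the two outer
  vertices of the \<open>k\<close>-th triangle (\<open>graph_dist_firefly\<close>). Up to simultaneous permutation \<open>E\<close> is
  block diagonal, with one block \<open>0\<close>, \<open>p\<close> blocks \<open>2\<close> and \<open>q = n - p\<close> blocks with rows
  \<open>(2, 1)\<close> and \<open>(1, 2)\<close>. Hence \<open>det (x I + E) = x (x + 2)\<^sup>p ((x + 1)(x + 3))\<^sup>q\<close>, and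
  \<open>x I - D\<close> differs from \<open>x I + E\<close> by a matrix of rank two.

  A low-rank change of a matrix multiplies its determinant by a small determinant
  (\<open>det_mat_on_low_rank_update\<close>), whose entries are sums over the vertex set and therefore do not
  depend on how the vertices are enumerated. The lemma is used twice: to compute
  \<open>det (x I + E)\<close> from its diagonal part, and to pass from \<open>x I + E\<close> to \<open>x I - D\<close>. With
  \<open>s = p / (x + 2) + 2 q / (x + 3)\<close> the second step gives the factor
  \<open>(1 - s)\<^sup>2 - s (s + 1 / x) = 1 - 2 s - s / x\<close>, and multiplying it by
  \<open>x (x + 2) (x + 3)\<close> gives the cubic of the theorem. So the characteristic polynomial is
  \<open>(x + 2)\<^bsup>p - 1\<^esup> (x + 1)\<^sup>q (x + 3)\<^bsup>q - 1\<^esup>\<close> times the cubic, first for \<open>x > 0\<close>,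
  where nothing that is divided by vanishes, and then identically.

  The cubic is negative at \<open>-3\<close>, positive at \<open>-2\<close>, negative at \<open>0\<close> and eventually positive.
  So it has three distinct real roots, and counting its real roots misses none.
\<close>

section \<open>Determinants under low-rank changes\<close>

text \<open>
  The two determinants are those of the Schur complements of the two identity blocks in the block
  matrix with rows \<open>(1, A)\<close> and \<open>(B, 1)\<close>. Multiplying that matrix on the right or on the left
  by the unipotent matrix with rows \<open>(1, 0)\<close> and \<open>(-B, 1)\<close> makes it block triangular and
  exhibits one complement or the other.
\<close>

lemma det_one_minus_mult_commute:
  fixes A B :: "'a :: idom mat"
  assumes A: "A \<in> carrier_mat n m" and B: "B \<in> carrier_mat m n"
  shows "det (1\<^sub>m n - A * B) = det (1\<^sub>m m - B * A)"
proof -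
  let ?M = "four_block_mat (1\<^sub>m n) A B (1\<^sub>m m)"
  let ?L = "four_block_mat (1\<^sub>m n) (0\<^sub>m n m) (- B) (1\<^sub>m m)"
  have M: "?M \<in> carrier_mat (n + m) (n + m)" and L: "?L \<in> carrier_mat (n + m) (n + m)"
    by auto
  have prod1: "?M * ?L = four_block_mat (1\<^sub>m n - A * B) A (0\<^sub>m m n) (1\<^sub>m m)"
    using A B
    by (subst mult_four_block_mat[where ?nr1.0 = n and ?n1.0 = n and ?n2.0 = m and ?nr2.0 = m
          and ?nc1.0 = n and ?nc2.0 = m])
       (auto intro!: arg_cong4[where f = four_block_mat] simp: minus_add_uminus_mat[of _ n n])
  have prod2: "?L * ?M = four_block_mat (1\<^sub>m n) A (0\<^sub>m m n) (1\<^sub>m m - B * A)"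
    using A B
    by (subst mult_four_block_mat[where ?nr1.0 = n and ?n1.0 = n and ?n2.0 = m and ?nr2.0 = m
          and ?nc1.0 = n and ?nc2.0 = m])
       (auto intro!: arg_cong4[where f = four_block_mat] simp: minus_add_uminus_mat[of _ m m])
  have "det (1\<^sub>m n - A * B) = det (?M * ?L)"
    unfolding prod1 using A B
    by (subst det_four_block_mat_lower_left_zero[where n = n and m = m]) auto
  also have "\<dots> = det (?L * ?M)"
    using det_mult[OF M L] det_mult[OF L M] by (simp add: mult.commute)
  also have "\<dots> = det (1\<^sub>m m - B * A)"
    unfolding prod2 using A B
    by (subst det_four_block_mat_lower_left_zero[where n = n and m = m]) auto
  finally show ?thesis .
qed

text \<open>
  Working with kernels on an arbitrary index type keeps the enumeration out of the calculations:
  the entries below become sums and products over \<open>set vs\<close>.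
\<close>

definition mat_on :: "'v list \<Rightarrow> ('v \<Rightarrow> 'v \<Rightarrow> 'a) \<Rightarrow> 'a mat" where
  "mat_on vs K = mat (length vs) (length vs) (\<lambda>(i, j). K (vs ! i) (vs ! j))"

lemma mat_on_carrier: "mat_on vs K \<in> carrier_mat (length vs) (length vs)"
  by (simp add: mat_on_def)

lemma mat_on_cong:
  assumes "\<And>u v. u \<in> set vs \<Longrightarrow> v \<in> set vs \<Longrightarrow> K u v = L u v"
  shows "mat_on vs K = mat_on vs L"
  using assms by (auto simp: mat_on_def intro!: eq_matI)

lemma sum_nth_distinct:
  assumes "distinct vs"
  shows "(\<Sum>i = 0..<length vs. f (vs ! i)) = (\<Sum>v\<in>set vs. f v)"
  using sum.reindex_bij_betw[OF bij_betw_nth[OF assms refl refl], of f]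
  by (simp add: atLeast0LessThan)

lemma prod_nth_distinct:
  assumes "distinct vs"
  shows "(\<Prod>i = 0..<length vs. f (vs ! i)) = (\<Prod>v\<in>set vs. f v)"
  using prod.reindex_bij_betw[OF bij_betw_nth[OF assms refl refl], of f]
  by (simp add: atLeast0LessThan)

text \<open>
  The change is written as \<open>(K R) B\<close> with a prescribed preimage \<open>R\<close> of its column factor. Then
  \<open>K - K R B = K (1 - R B)\<close>, and \<open>det (1 - R B) = det (1 - B R)\<close> is an \<open>m\<close> by \<open>m\<close>
  determinant. Supplying \<open>R\<close> avoids inverting \<open>K\<close>.
\<close>

lemma det_mat_on_low_rank_update:
  fixes K :: "'v \<Rightarrow> 'v \<Rightarrow> 'a :: idom" and r b :: "nat \<Rightarrow> 'v \<Rightarrow> 'a"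
  assumes vs: "distinct vs"
  shows "det (mat_on vs (\<lambda>u w. K u w - (\<Sum>k<m. (\<Sum>v\<in>set vs. K u v * r k v) * b k w))) =
    det (mat_on vs K) *
    det (mat m m (\<lambda>(k, l). (if k = l then 1 else 0) - (\<Sum>v\<in>set vs. b k v * r l v)))"
proof -
  let ?N = "length vs"
  define R where "R = mat ?N m (\<lambda>(i, k). r k (vs ! i))"
  define B where "B = mat m ?N (\<lambda>(k, j). b k (vs ! j))"
  have R: "R \<in> carrier_mat ?N m" and B: "B \<in> carrier_mat m ?N"
    by (simp_all add: R_def B_def)
  note K = mat_on_carrier[of vs K]
  have "mat_on vs (\<lambda>u w. K u w - (\<Sum>k<m. (\<Sum>v\<in>set vs. K u v * r k v) * b k w)) =
      mat_on vs K - (mat_on vs K * R) * B"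
    by (rule eq_matI)
      (auto simp: mat_on_def R_def B_def scalar_prod_def atLeast0LessThan
        sum_nth_distinct[OF vs, symmetric])
  also have "\<dots> = mat_on vs K * (1\<^sub>m ?N - R * B)"
    using K R B by (subst mult_minus_distrib_mat[OF K]) auto
  finally have "det (mat_on vs (\<lambda>u w. K u w - (\<Sum>k<m. (\<Sum>v\<in>set vs. K u v * r k v) * b k w))) =
      det (mat_on vs K) * det (1\<^sub>m ?N - R * B)"
    by (simp add: det_mult[OF K minus_carrier_mat[OF mult_carrier_mat[OF R B]]])
  also have "det (1\<^sub>m ?N - R * B) = det (1\<^sub>m m - B * R)"
    by (rule det_one_minus_mult_commute[OF R B])
  also have "1\<^sub>m m - B * R =
      mat m m (\<lambda>(k, l). (if k = l then 1 else 0) - (\<Sum>v\<in>set vs. b k v * r l v))"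
    by (rule eq_matI)
      (auto simp: R_def B_def scalar_prod_def sum_nth_distinct[OF vs, symmetric])
  finally show ?thesis .
qed

lemma det_diagonal:
  "det (mat n n (\<lambda>(i, j). if i = j then f i else 0)) = (\<Prod>i = 0..<n. f i)"
  by (subst det_upper_triangular[where n = n])
    (auto simp: upper_triangular_def prod_list_diag_prod)

lemma det_mat_on_diagonal:
  assumes "distinct vs"
  shows "det (mat_on vs (\<lambda>u v. if u = v then d u else 0)) = (\<Prod>v\<in>set vs. d v)"
proof -
  have "mat_on vs (\<lambda>u v. if u = v then d u else 0) =
      mat (length vs) (length vs) (\<lambda>(i, j). if i = j then d (vs ! i) else 0)"
    using assms by (auto simp: mat_on_def nth_eq_iff_index_eq intro!: eq_matI)
  then show ?thesis
    by (simp add: det_diagonal prod_nth_distinct[OF assms])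
qed

lemma det_two_by_two:
  fixes f :: "nat \<times> nat \<Rightarrow> 'a :: comm_ring_1"
  shows "det (mat 2 2 f) = f (0, 0) * f (1, 1) - f (0, 1) * f (1, 0)"
  by (subst laplace_expansion_row[of _ 2 0])
    (auto simp: numeral_2_eq_2 cofactor_def mat_delete_def det_single)

lemma poly_char_poly_mat_on:
  fixes K :: "'v \<Rightarrow> 'v \<Rightarrow> 'a :: field"
  assumes "distinct vs"
  shows "poly (char_poly (mat_on vs K)) x =
    det (mat_on vs (\<lambda>u v. (if u = v then x else 0) - K u v))"
proof -
  have "- char_matrix (mat_on vs K) x = mat_on vs (\<lambda>u v. (if u = v then x else 0) - K u v)"
    using assms by (auto simp: char_matrix_def mat_on_def nth_eq_iff_index_eq intro!: eq_matI)
  then show ?thesis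
    by (simp add: char_poly_matrix[OF mat_on_carrier])
qed

section \<open>Distances in the firefly graph\<close>

lemma (in wf_digraph) shortest_walk_imp_\<mu>:
  assumes "awalk u p v" and "\<And>q. awalk u q v \<Longrightarrow> length p \<le> length q"
  shows "\<mu> (\<lambda>_. 1) u v = ereal (length p)"
proof -
  have cost: "awalk_cost (\<lambda>_. 1) q = length q" for q :: "'b list"
    by (induction q) auto
  show ?thesis
    unfolding \<mu>_def cost using assms by (intro INF_eqI) auto
qed

lemma (in pair_graph) graph_dist_refl:
  "u \<in> pverts G \<Longrightarrow> graph_dist G u u = 0"
  using shortest_walk_imp_\<mu>[of u "[]" u] by (simp add: graph_dist_def awalk_Nil_iff)

lemma (in pair_graph) graph_dist_arc:
  assumes "(u, v) \<in> parcs G" shows "graph_dist G u v = 1"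
proof -
  have "u \<noteq> v" using assms no_loops' by auto
  have "awalk u [(u,v)] v" using assms by (auto simp: awalk_simps dest: in_arcsD1 in_arcsD2)
  moreover have "length [(u,v)] \<le> length q" if "awalk u q v" for q
    using that \<open>u \<noteq> v\<close> by (cases q) (auto simp: awalk_simps)
  ultimately show ?thesis
    using shortest_walk_imp_\<mu>[of u "[(u,v)]" v] by (simp add: graph_dist_def)
qed

lemma (in pair_graph) graph_dist_common_neighbour:
  assumes "(u, w) \<in> parcs G" "(w, v) \<in> parcs G" "u \<noteq> v" "(u, v) \<notin> parcs G"
  shows "graph_dist G u v = 2"
proof -
  have "awalk u [(u,w),(w,v)] v" using assms by (auto simp: awalk_simps dest: in_arcsD1 in_arcsD2)
  moreover have "length [(u,w),(w,v)] \<le> length q" if "awalk u q v" for q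
    using that assms(3,4)
    by (cases q; cases "tl q") (auto simp: awalk_simps)
  ultimately show ?thesis
    using shortest_walk_imp_\<mu>[of u "[(u,w),(w,v)]" v] by (simp add: graph_dist_def)
qed

text \<open>
  In the vertex type, the centre is \<open>Inl 0\<close>, the pendant vertices are \<open>Inr (Inl (i, 0))\<close> with
  \<open>i < p\<close>, and the outer vertices of triangle \<open>i < q\<close> are \<open>Inr (Inr (i, 0))\<close> and
  \<open>Inr (Inr (i, 1))\<close>.
\<close>

fun centre_dist :: "nat + (nat \<times> nat + nat \<times> nat) \<Rightarrow> real" where
  "centre_dist (Inl _) = 0"
| "centre_dist (Inr _) = 1"

fun in_triangle :: "nat \<Rightarrow> nat + (nat \<times> nat + nat \<times> nat) \<Rightarrow> real" where
  "in_triangle k (Inr (Inr (i, _))) = (if i = k then 1 else 0)"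
| "in_triangle k (Inr (Inl _)) = 0"
| "in_triangle k (Inl _) = 0"

text \<open>
  The excess over the true distance 0 of the closed walk from a vertex to the centre and back.
  For an outer triangle vertex this is 2, of which 1 is already accounted for by the indicator of
  its triangle.
\<close>

fun diag_excess :: "nat + (nat \<times> nat + nat \<times> nat) \<Rightarrow> real" where
  "diag_excess (Inl _) = 0"
| "diag_excess (Inr (Inl _)) = 2"
| "diag_excess (Inr (Inr _)) = 1"

lemmas graph_defs = firefly_def graph_join_def disjoint_union_def disjoint_copies_def
  complete_graph_def

lemma pverts_firefly:
  "pverts (firefly p q) = {..<1} <+> (({..<p} \<times> {..<1}) <+> ({..<q} \<times> {..<2}))"
  by (simp add: graph_defs)

lemma pverts_firefly_cases:
  assumes "v \<in> pverts (firefly p q)"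
  obtains (centre) "v = Inl 0"
  | (pendant) i where "i < p" "v = Inr (Inl (i, 0))"
  | (triangle) i a where "i < q" "a < 2" "v = Inr (Inr (i, a))"
  using assms by (auto simp: pverts_firefly)

lemma parcs_firefly_iff:
  assumes "u \<in> pverts (firefly p q)" "v \<in> pverts (firefly p q)"
  shows "(u, v) \<in> parcs (firefly p q) \<longleftrightarrow>
    u \<noteq> v \<and> (u = Inl 0 \<or> v = Inl 0 \<or> (\<exists>k. in_triangle k u = 1 \<and> in_triangle k v = 1))"
  using assms(1)
  by (cases rule: pverts_firefly_cases; use assms(2) in \<open>cases rule: pverts_firefly_cases\<close>)
    (auto simp: graph_defs)

lemma sum_pverts_firefly:
  "(\<Sum>v\<in>pverts (firefly p q). f v) =
    f (Inl 0) + (\<Sum>i<p. f (Inr (Inl (i, 0)))) +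
    (\<Sum>i<q. f (Inr (Inr (i, 0))) + f (Inr (Inr (i, 1))))" for f :: "_ \<Rightarrow> real"
proof -
  have pairs: "(\<Sum>x\<in>A \<times> B. g x) = (\<Sum>i\<in>A. \<Sum>j\<in>B. g (i, j))"
    for A B :: "nat set" and g :: "nat \<times> nat \<Rightarrow> real"
    by (simp add: sum.cartesian_product)
  show ?thesis
    by (simp add: pverts_firefly sum.Plus pairs comp_def numeral_2_eq_2 lessThan_Suc add_ac)
qed

lemma prod_pverts_firefly:
  "(\<Prod>v\<in>pverts (firefly p q). f v) =
    f (Inl 0) * (\<Prod>i<p. f (Inr (Inl (i, 0)))) *
    (\<Prod>i<q. f (Inr (Inr (i, 0))) * f (Inr (Inr (i, 1))))" for f :: "_ \<Rightarrow> real"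
proof -
  have pairs: "(\<Prod>x\<in>A \<times> B. g x) = (\<Prod>i\<in>A. \<Prod>j\<in>B. g (i, j))"
    for A B :: "nat set" and g :: "nat \<times> nat \<Rightarrow> real"
    by (simp add: prod.cartesian_product)
  show ?thesis
    by (simp add: pverts_firefly prod.Plus pairs comp_def numeral_2_eq_2 lessThan_Suc mult_ac)
qed

lemma sum_indicator_mult:
  fixes i q :: nat
  assumes "i < q"
  shows "(\<Sum>k<q. (if i = k then 1 else 0) * (if j = k then 1 else 0)) =
    (if i = j then 1 else (0 :: real))"
proof (cases "i = j")
  case True
  have "(\<Sum>k<q. (if j = k then 1 else 0) * (if j = k then 1 else 0)) =
      (\<Sum>k<q. if j = k then 1 else (0 :: real))"
    by (intro sum.cong) auto
  then show ?thesis using True assms by simp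
qed (auto intro: sum.neutral)

lemma sum_in_triangle_mult:
  assumes "k < q"
  shows "(\<Sum>v\<in>pverts (firefly p q). in_triangle k v * in_triangle l v) = (if k = l then 2 else 0)"
proof -
  have "(\<Sum>v\<in>pverts (firefly p q). in_triangle k v * in_triangle l v) =
      (\<Sum>i<q. 2 * ((if k = i then 1 else 0) * (if l = i then 1 else 0)))"
    unfolding sum_pverts_firefly in_triangle.simps
    by (simp only: mult_zero_left sum.neutral_const add_0_left, intro sum.cong) auto
  then show ?thesis
    by (simp only: sum_distrib_left[symmetric] sum_indicator_mult[OF assms]) simp
qed

text \<open>
  The walk through the centre is too long in two cases only: from an outer vertex to itself, and
  between the two outer vertices of one triangle, where the arc saves one step.
\<close>

lemma graph_dist_firefly:
  assumes u: "u \<in> pverts (firefly p q)" and v: "v \<in> pverts (firefly p q)"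
  shows "graph_dist (firefly p q) u v =
    centre_dist u + centre_dist v - (if u = v then diag_excess u else 0)
    - (\<Sum>k<q. in_triangle k u * in_triangle k v)"
proof -
  interpret pair_graph "firefly p q" by (rule pair_graph_firefly)
  have centre: "Inl 0 \<in> pverts (firefly p q)" by (auto simp: pverts_firefly)
  have dist: "graph_dist (firefly p q) u v =
      (if u = v then 0 else if (u, v) \<in> parcs (firefly p q) then 1 else 2)"
    using graph_dist_refl[OF u] graph_dist_arc[of u v]
      graph_dist_common_neighbour[of u "Inl 0" v]
      parcs_firefly_iff[OF u v] parcs_firefly_iff[OF u centre] parcs_firefly_iff[OF centre v]
    by auto
  show ?thesis
    unfolding dist parcs_firefly_iff[OF u v] using u
    by (cases rule: pverts_firefly_cases; use v in \<open>cases rule: pverts_firefly_cases\<close>)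
      (auto simp: sum_indicator_mult)
qed

section \<open>The characteristic polynomial\<close>

text \<open>
  The triangle indicators \<open>t\<^sub>k\<close> have disjoint supports, on which the diagonal part is constant
  \<open>x + 1\<close>. So they are eigenvectors of the diagonal part and pairwise orthogonal of square
  length 2: the small determinant is diagonal, and each triangle contributes the factor
  \<open>1 + 2 / (x + 1) = (x + 3) / (x + 1)\<close>.
\<close>

lemma det_mat_on_firefly_local:
  assumes vs: "distinct vs" "set vs = pverts (firefly p q)" and x: "x > 0"
  shows "det (mat_on vs (\<lambda>u v. (if u = v then x + diag_excess u else 0) +
      (\<Sum>k<q. in_triangle k u * in_triangle k v))) = x * (x + 2) ^ p * (x + 1) ^ q * (x + 3) ^ q"
proof -
  let ?d = "\<lambda>u v. if u = v then x + diag_excess u else 0"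
  have unit_on_triangles: "(x + diag_excess u) * (in_triangle k u / (x + 1)) = in_triangle k u" for k u
    using x by (cases "(k, u)" rule: in_triangle.cases) auto
  have "mat_on vs (\<lambda>u v. ?d u v + (\<Sum>k<q. in_triangle k u * in_triangle k v)) =
      mat_on vs (\<lambda>u w. ?d u w -
        (\<Sum>k<q. (\<Sum>v\<in>set vs. ?d u v * - (in_triangle k v / (x + 1))) * in_triangle k w))"
  proof (rule mat_on_cong)
    fix u v assume u: "u \<in> set vs"
    have "(\<Sum>v\<in>set vs. ?d u v * - (in_triangle k v / (x + 1))) = - in_triangle k u" for k
    proof -
      have "(\<Sum>v\<in>set vs. ?d u v * - (in_triangle k v / (x + 1))) =
          (\<Sum>v\<in>set vs. if u = v then (x + diag_excess u) * - (in_triangle k u / (x + 1)) else 0)"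
        by (intro sum.cong) auto
      then show ?thesis using u unit_on_triangles[of u k] by simp
    qed
    then show "?d u v + (\<Sum>k<q. in_triangle k u * in_triangle k v) =
        ?d u v -
        (\<Sum>k<q. (\<Sum>v\<in>set vs. ?d u v * - (in_triangle k v / (x + 1))) * in_triangle k v)"
      by (simp add: sum_negf)
  qed
  moreover have "(if k = l then 1 else 0) -
        (\<Sum>v\<in>set vs. in_triangle k v * - (in_triangle l v / (x + 1))) =
      (if k = l then (x + 3) / (x + 1) else 0)" if k: "k < q" for k l
  proof -
    have "(\<Sum>v\<in>set vs. in_triangle k v * - (in_triangle l v / (x + 1))) =
        - (\<Sum>v\<in>set vs. in_triangle k v * in_triangle l v) / (x + 1)"
      by (simp add: sum_divide_distrib sum_negf)
    also have "\<dots> = - (if k = l then 2 else 0) / (x + 1)"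
      unfolding vs(2) sum_in_triangle_mult[OF k] ..
    finally have eq: "(\<Sum>v\<in>set vs. in_triangle k v * - (in_triangle l v / (x + 1))) =
        - (if k = l then 2 else 0) / (x + 1)" .
    have "(x + 3) / (x + 1) = ((x + 1) + 2) / (x + 1)" by simp
    also have "\<dots> = 1 + 2 / (x + 1)" using x by (simp only: add_divide_distrib[of "x + 1" 2]) simp
    finally show ?thesis unfolding eq by simp
  qed
  then have "mat q q (\<lambda>(k, l). (if k = l then 1 else 0) -
        (\<Sum>v\<in>set vs. in_triangle k v * - (in_triangle l v / (x + 1)))) =
      mat q q (\<lambda>(k, l). if k = l then (x + 3) / (x + 1) else 0)"
    by (intro cong_mat refl) (simp only: prod.case)
  moreover have "det (mat_on vs ?d) = x * (x + 2) ^ p * ((x + 1) * (x + 1)) ^ q"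
    by (simp add: det_mat_on_diagonal[OF vs(1)] vs(2) prod_pverts_firefly)
  ultimately show ?thesis
    using x
    by (simp only: det_mat_on_low_rank_update[OF vs(1)] det_diagonal)
      (simp add: power_mult_distrib power_divide)
qed

text \<open>
  The vector that is \<open>c\<close> at the centre and 1 elsewhere is needed for \<open>c = 0\<close> (the distances to
  the centre) and \<open>c = 1\<close> (the all-ones vector). Its preimage under \<open>x I + E\<close> is constant on each
  kind of vertex; off the centre, the values are the reciprocals of the row sums \<open>x + 2\<close> and
  \<open>(x + 2) + 1\<close> of the blocks.
\<close>

fun local_preimage :: "real \<Rightarrow> real \<Rightarrow> nat + (nat \<times> nat + nat \<times> nat) \<Rightarrow> real" where
  "local_preimage x c (Inl _) = c / x"
| "local_preimage x c (Inr (Inl _)) = 1 / (x + 2)"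
| "local_preimage x c (Inr (Inr _)) = 1 / (x + 3)"

lemma local_preimage:
  assumes x: "x > 0" and u: "u \<in> pverts (firefly p q)"
  shows "(\<Sum>v\<in>pverts (firefly p q). ((if u = v then x + diag_excess u else 0) +
      (\<Sum>k<q. in_triangle k u * in_triangle k v)) * local_preimage x c v) =
    c + (1 - c) * centre_dist u"
proof -
  have "finite (pverts (firefly p q))"
    by (auto simp: pverts_firefly)
  have "(\<Sum>v\<in>pverts (firefly p q). (if u = v then x + diag_excess u else 0) * local_preimage x c v) =
      (\<Sum>v\<in>pverts (firefly p q). if u = v then (x + diag_excess u) * local_preimage x c u else 0)"
    by (intro sum.cong) auto
  also have "\<dots> = (x + diag_excess u) * local_preimage x c u"
    using u \<open>finite _\<close> by simp
  finally have diag: "(\<Sum>v\<in>pverts (firefly p q).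
      (if u = v then x + diag_excess u else 0) * local_preimage x c v) =
      (x + diag_excess u) * local_preimage x c u" .
  have tri: "(\<Sum>v\<in>pverts (firefly p q).
      (\<Sum>k<q. in_triangle k u * in_triangle k v) * local_preimage x c v) =
      (case u of Inr (Inr _) \<Rightarrow> 2 / (x + 3) | _ \<Rightarrow> 0)"
    using u
  proof (cases rule: pverts_firefly_cases)
    case (triangle i a)
    have "(\<Sum>v\<in>pverts (firefly p q).
      (\<Sum>k<q. in_triangle k u * in_triangle k v) * local_preimage x c v) =
      (\<Sum>j<q. if i = j then 2 / (x + 3) else 0)"
      by (simp add: sum_pverts_firefly triangle(3) sum_indicator_mult[OF triangle(1)]
          del: sum.delta sum.delta', intro sum.cong) auto
    then show ?thesis using triangle by simp
  qed (simp_all add: sum_pverts_firefly)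
  show ?thesis
    using u x
    by (simp only: distrib_right[of "if _ then _ else _"] sum.distrib diag tri,
        cases rule: pverts_firefly_cases)
      (auto simp: add_divide_distrib[symmetric])
qed

lemma sum_local_preimage:
  "(\<Sum>v\<in>pverts (firefly p q). local_preimage x c v) =
    c / x + real p / (x + 2) + 2 * real q / (x + 3)"
  "(\<Sum>v\<in>pverts (firefly p q). centre_dist v * local_preimage x c v) =
    real p / (x + 2) + 2 * real q / (x + 3)"
  by (simp_all add: sum_pverts_firefly)

text \<open>
  The rank-two part of \<open>D\<close> is \<open>h 1\<^sup>T + 1 h\<^sup>T\<close>. The column factors \<open>h\<close> and \<open>1\<close> have the
  preimages \<open>local_preimage x 0\<close> and \<open>local_preimage x 1\<close>, and the matching row factors are
  \<open>1\<close> and \<open>h\<close>, in this order.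
\<close>

lemma poly_char_poly_firefly:
  assumes vs: "distinct vs" "set vs = pverts (firefly p q)" and x: "x > 0"
  shows "poly (char_poly (distance_matrix (firefly p q) vs)) x =
    x * (x + 2) ^ p * (x + 1) ^ q * (x + 3) ^ q *
    ((1 - (real p / (x + 2) + 2 * real q / (x + 3)))\<^sup>2 -
     (real p / (x + 2) + 2 * real q / (x + 3)) * (1 / x + real p / (x + 2) + 2 * real q / (x + 3)))"
proof -
  let ?K = "\<lambda>u v. (if u = v then x + diag_excess u else 0) +
      (\<Sum>k<q. in_triangle k u * in_triangle k v)"
  let ?r = "\<lambda>k. local_preimage x (real k)"
  let ?b = "\<lambda>k. if k = (0 :: nat) then (\<lambda>_. 1) else centre_dist"
  have "distance_matrix (firefly p q) vs = mat_on vs (graph_dist (firefly p q))"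
    by (simp add: distance_matrix_def mat_on_def)
  then have "poly (char_poly (distance_matrix (firefly p q) vs)) x =
      det (mat_on vs (\<lambda>u v. (if u = v then x else 0) - graph_dist (firefly p q) u v))"
    by (simp add: poly_char_poly_mat_on[OF vs(1)])
  also have "mat_on vs (\<lambda>u v. (if u = v then x else 0) - graph_dist (firefly p q) u v) =
      mat_on vs (\<lambda>u w. ?K u w - (\<Sum>k<2. (\<Sum>v\<in>set vs. ?K u v * ?r k v) * ?b k w))"
    by (rule mat_on_cong)
      (simp add: vs(2) graph_dist_firefly local_preimage[OF x] numeral_2_eq_2 lessThan_Suc)
  also have "det \<dots> = x * (x + 2) ^ p * (x + 1) ^ q * (x + 3) ^ q *
    ((1 - (real p / (x + 2) + 2 * real q / (x + 3)))\<^sup>2 -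
     (real p / (x + 2) + 2 * real q / (x + 3)) * (1 / x + real p / (x + 2) + 2 * real q / (x + 3)))"
    unfolding det_mat_on_low_rank_update[OF vs(1)] det_mat_on_firefly_local[OF vs x]
      det_two_by_two
    by (simp add: vs(2) sum_local_preimage power2_eq_square) (simp add: algebra_simps)
  finally show ?thesis .
qed

text \<open>
  Both sides agree at every positive \<open>x\<close>, where the rational expression for the determinant is
  valid, and two polynomials that agree at infinitely many points are equal.
\<close>

lemma char_poly_firefly:
  fixes p q :: nat
  defines "n \<equiv> p + q"
  assumes vs: "distinct vs" "set vs = pverts (firefly p q)" and p: "p \<ge> 1" and q: "q \<ge> 1"
  shows "char_poly (distance_matrix (firefly p q) vs) =
    [:2, 1:] ^ (p - 1) * [:1, 1:] ^ q * [:3, 1:] ^ (q - 1) *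
    [:- (4 * real n - real p), - (10 * real n - 3 * real p - 6),
      - (4 * real n - 2 * real p - 5), 1:]"
    (is "?\<chi> = ?g")
proof (rule ccontr)
  assume "?\<chi> \<noteq> ?g"
  then have "finite {x. poly (?\<chi> - ?g) x = 0}" by (intro poly_roots_finite) auto
  moreover have "{0<..} \<subseteq> {x. poly (?\<chi> - ?g) x = 0}"
  proof
    fix x :: real assume "x \<in> {0<..}"
    then have x: "x > 0" by simp
    obtain p' q' where p': "p = Suc p'" and q': "q = Suc q'"
      using p q by (cases p; cases q) auto
    define s where "s = real p / (x + 2) + 2 * real q / (x + 3)"
    have factor: "x * (x + 2) * (x + 3) * ((1 - s)\<^sup>2 - s * (1 / x + s)) =
      poly [:- (4 * real n - real p), - (10 * real n - 3 * real p - 6),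
      - (4 * real n - 2 * real p - 5), 1:] x"
    proof -
      define a b c where "a = real p / (x + 2)" and "b = 2 * real q / (x + 3)" and "c = 1 / x"
      have "(x + 2) * a = p" "(x + 3) * b = 2 * real q" "x * c = 1" "s = a + b"
        using x by (simp_all add: a_def b_def c_def s_def)
      have "(x + 2) * (x + 3) * s = (x + 3) * ((x + 2) * a) + (x + 2) * ((x + 3) * b)"
        by (simp add: \<open>s = a + b\<close> algebra_simps)
      also have "\<dots> = real p * (x + 3) + 2 * real q * (x + 2)"
        unfolding \<open>(x + 2) * a = p\<close> \<open>(x + 3) * b = 2 * real q\<close> by (simp add: mult.commute)
      finally have s: "(x + 2) * (x + 3) * s = real p * (x + 3) + 2 * real q * (x + 2)" .
      have "x * (x + 2) * (x + 3) * ((1 - s)\<^sup>2 - s * (c + s)) =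
          x * (x + 2) * (x + 3) - (2 * x + x * c) * ((x + 2) * (x + 3) * s)"
        by (simp add: power2_eq_square algebra_simps)
      then have "x * (x + 2) * (x + 3) * ((1 - s)\<^sup>2 - s * (c + s)) =
          x * (x + 2) * (x + 3) - (2 * x + 1) * (real p * (x + 3) + 2 * real q * (x + 2))"
        unfolding s \<open>x * c = 1\<close> .
      then show ?thesis
        by (simp add: n_def c_def algebra_simps)
    qed
    have "poly ?\<chi> x = (x + 2) ^ p' * (x + 1) ^ q * (x + 3) ^ q' *
       (x * (x + 2) * (x + 3) * ((1 - s)\<^sup>2 - s * (1 / x + s)))"
      unfolding poly_char_poly_firefly[OF vs x] s_def by (simp add: p' q' add.assoc mult_ac)
    then have "poly ?\<chi> x = poly ?g x"
      unfolding factor by (simp only: poly_mult poly_power) (simp add: p' q' add_ac)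
    then show "x \<in> {x. poly (?\<chi> - ?g) x = 0}"
      by (simp only: mem_Collect_eq poly_diff diff_self)
  qed
  ultimately show False
    using infinite_Ioi[of "0 :: real"] finite_subset by blast
qed

section \<open>The roots of the cubic factor\<close>

lemma proots_monic_cubic_interlaced:
  fixes b c d x0 x1 x2 x3 :: real
  defines "f \<equiv> [:d, c, b, 1:]"
  assumes "x0 < x1" "x1 < x2" "x2 < x3"
    and signs: "poly f x0 < 0" "poly f x1 > 0" "poly f x2 < 0" "poly f x3 > 0"
  shows "\<exists>l1 l2 l3. proots f = {#l1, l2, l3#}"
proof -
  obtain l1 where l1: "x0 < l1" "l1 < x1" "poly f l1 = 0"
    using poly_IVT_pos[OF \<open>x0 < x1\<close> signs(1,2)] by blast
  obtain l2 where l2: "x1 < l2" "l2 < x2" "poly f l2 = 0"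
    using poly_IVT_neg[OF \<open>x1 < x2\<close> signs(2,3)] by blast
  obtain l3 where l3: "x2 < l3" "l3 < x3" "poly f l3 = 0"
    using poly_IVT_pos[OF \<open>x2 < x3\<close> signs(3,4)] by blast
  have f0: "f \<noteq> 0" and deg: "degree f = 3" by (simp_all add: f_def)
  have "mset_set {l1, l2, l3} \<subseteq># mset_set (set_mset (proots f))"
    using f0 l1 l2 l3 by (intro subset_imp_msubset_mset_set) (auto simp: poly_roots_finite)
  then have sub: "mset_set {l1, l2, l3} \<subseteq># proots f"
    using mset_set_set_mset_msubset subset_mset.order_trans by blast
  have distinct: "mset_set {l1, l2, l3} = {#l1, l2, l3#}"
    using l1 l2 l3 by auto
  have "size (proots f) \<le> size {#l1, l2, l3#}"
    using size_proots_le[of f] deg by simp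
  then have "proots f = {#l1, l2, l3#}"
    using sub unfolding distinct
    by (metis mset_subset_size subset_mset.le_imp_less_or_eq linorder_not_less)
  then show ?thesis by blast
qed

lemma proots_firefly_cubic:
  fixes p q :: real
  defines "n \<equiv> p + q"
  assumes "p > 0" "q > 0"
  shows "\<exists>l1 l2 l3. proots [:- (4 * n - p), - (10 * n - 3 * p - 6), - (4 * n - 2 * p - 5), 1:] =
    {#l1, l2, l3#}"
proof -
  let ?f = "[:- (4 * n - p), - (10 * n - 3 * p - 6), - (4 * n - 2 * p - 5), 1:]"
  \<comment> \<open>A point to the right of all roots, far enough for every intermediate value of the Horner
    scheme to be positive.\<close>
  define x where "x = 10 * n + 10"
  have x: "x > 0" and n: "p < n" using assms by (simp_all add: x_def)
  have "poly ?f x = x * (x * (x - (4 * n - 2 * p - 5)) - (10 * n - 3 * p - 6)) - (4 * n - p)"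
    by (simp add: algebra_simps)
  also have "\<dots> > 0"
  proof -
    define y where "y = x - (4 * n - 2 * p - 5)"
    have "1 \<le> y" using assms by (simp add: y_def x_def)
    then have "x * 1 \<le> x * y" using x by (intro mult_left_mono) auto
    then have "1 \<le> x * y - (10 * n - 3 * p - 6)" using assms x_def by linarith
    then have "x * 1 \<le> x * (x * y - (10 * n - 3 * p - 6))"
      using x by (intro mult_left_mono) auto
    then have "x * (x * y - (10 * n - 3 * p - 6)) - (4 * n - p) > 0"
      using assms(2,3) n x_def by linarith
    then show ?thesis by (simp only: y_def)
  qed
  finally have "poly ?f x > 0" .
  then show ?thesis
    using assms x
    by (intro proots_monic_cubic_interlaced[of "-3" "-2" 0 x]) (simp_all add: algebra_simps)
qed

section \<open>The distance spectrum\<close>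

theorem corollary4p3:
  fixes n p :: nat
    and vs :: "(nat + (nat \<times> nat + nat \<times> nat)) list"
  assumes "1 \<le> p" and "p \<le> n - 1"
    and "distinct vs" and "set vs = pverts (firefly p (n - p))"
  shows "\<exists>l1 l2 l3 :: real.
    proots [: - (4 * real n - real p),
              - (10 * real n - 3 * real p - 6),
              - (4 * real n - 2 * real p - 5),
              1 :] = {#l1, l2, l3#} \<and>
    eigenvalue_mset (distance_matrix (firefly p (n - p)) vs) =
      replicate_mset (p - 1) (- 2) + replicate_mset (n - p) (- 1)
      + replicate_mset (n - p - 1) (- 3) + {#l1, l2, l3#}"
proof -
  have n: "p + (n - p) = n" and q: "1 \<le> n - p" using assms(1,2) by simp_all
  have n_real: "real p + real (n - p) = real n" using n by linarith
  have "real p > 0" "real (n - p) > 0"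
    using assms(1) q by simp_all
  from proots_firefly_cubic[OF this] obtain l1 l2 l3 where l:
    "proots [: - (4 * real n - real p), - (10 * real n - 3 * real p - 6),
      - (4 * real n - 2 * real p - 5), 1 :] = {#l1, l2, l3#}"
    unfolding n_real by blast
  have "eigenvalue_mset (distance_matrix (firefly p (n - p)) vs) =
      replicate_mset (p - 1) (- 2) + replicate_mset (n - p) (- 1)
      + replicate_mset (n - p - 1) (- 3) + {#l1, l2, l3#}"
    unfolding eigenvalue_mset_def char_poly_firefly[OF assms(3,4,1) q, unfolded n]
    using l by (simp add: proots_mult proots_power del: mult_pCons_left mult_pCons_right)
  with l show ?thesis by blast
qed

end
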